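(* Let $u$ be a quasi-definite linear functional on $\mathbb{C}[x]$ (for instance a Borel measure), with monic orthogonal polynomials $P_n$. For $n\ge0$ the Christoffel–Darboux kernel satisfies $$(x-y)K_n(x,y)=P_n(y)H_n^{-1}P_{n+1}(x)-P_{n+1}(y)H_n^{-1}P_n(x),$$ with confluent version, for $l\ge1$, $$\sum_{k=0}^{l-1}\frac{(P_k(x))^2}{H_k}=\frac1{H_{l-1}}\Big(P_l'(x)P_{l-1}(x)-P_{l-1}'(x)P_l(x)\Big).$$
   Context: The moment matrix is $G_{i,j}=u(x^{i+j})$, $i,j\ge0$; quasi-definite means that all its leading principal minors are nonzero. Then uniquely $G=S^{-1}HS^{-\top}$ with $S$ lower unitriangular and $H=\operatorname{diag}(H_0,H_1,\dots)$; the monic orthogonal polynomials are the entries of $S(1,x,x^2,\dots)^\top=(P_0,P_1,\dots)^\top$, and $K_n(x,y)=\sum_{k=0}^nP_k(y)H_k^{-1}P_k(x)$. *)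

theory Defs
  imports
    Complex_Main
    "HOL-Library.Groups_Big_Fun"
    "HOL-Computational_Algebra.Polynomial"
    "Jordan_Normal_Form.Determinant"
begin

text \<open>
  Semi-infinite matrices are functions on pairs of indices. \<^const>\<open>Sum_any\<close> is the sum of a
  finitely supported function; in every product formed below, each row of the left factor has
  finite support, so all entries are genuine finite sums.
\<close>

type_synonym 'a smat = "nat \<Rightarrow> nat \<Rightarrow> 'a"

definition smat_mult :: "'a::semiring_0 smat \<Rightarrow> 'a smat \<Rightarrow> 'a smat"  (infixl "\<odot>" 70) where
  "A \<odot> B = (\<lambda>i j. Sum_any (\<lambda>k. A i k * B k j))"

definition smat_transpose :: "'a smat \<Rightarrow> 'a smat" where
  "smat_transpose A = (\<lambda>i j. A j i)"

definition smat_diag :: "(nat \<Rightarrow> 'a::zero) \<Rightarrow> 'a smat" where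
  "smat_diag d = (\<lambda>i j. if i = j then d i else 0)"

definition smat_one :: "'a::zero_neq_one smat" where
  "smat_one = smat_diag (\<lambda>_. 1)"

definition lower_unitriangular :: "'a::zero_neq_one smat \<Rightarrow> bool" where
  "lower_unitriangular A \<longleftrightarrow> (\<forall>i. A i i = 1) \<and> (\<forall>i j. i < j \<longrightarrow> A i j = 0)"

text \<open>
  \<open>T\<close> is the inverse of \<open>S\<close> in the group of lower unitriangular semi-infinite matrices.
\<close>

definition unitriangular_inverse :: "'a::semiring_1 smat \<Rightarrow> 'a smat \<Rightarrow> bool" where
  "unitriangular_inverse S T \<longleftrightarrow>
     lower_unitriangular S \<and> lower_unitriangular T \<and> S \<odot> T = smat_one \<and> T \<odot> S = smat_one"

definition linear_functional :: "(complex poly \<Rightarrow> complex) \<Rightarrow> bool" where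
  "linear_functional u \<longleftrightarrow> Vector_Spaces.linear smult (*) u"

definition moment_matrix :: "(complex poly \<Rightarrow> complex) \<Rightarrow> complex smat" where
  "moment_matrix u = (\<lambda>i j. u (monom 1 (i + j)))"

definition quasi_definite :: "(complex poly \<Rightarrow> complex) \<Rightarrow> bool" where
  "quasi_definite u \<longleftrightarrow> (\<forall>n. det (mat n n (\<lambda>(i, j). moment_matrix u i j)) \<noteq> 0)"

definition is_gauss_borel ::
    "(complex poly \<Rightarrow> complex) \<Rightarrow> complex smat \<Rightarrow> (nat \<Rightarrow> complex) \<Rightarrow> bool" where
  "is_gauss_borel u S H \<longleftrightarrow>
     (\<exists>T. unitriangular_inverse S T \<and>
          moment_matrix u = T \<odot> smat_diag H \<odot> smat_transpose T)"

text \<open>For quasi-definite functionals the factorization exists and is unique.\<close>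

definition gauss_borel ::
    "(complex poly \<Rightarrow> complex) \<Rightarrow> complex smat \<times> (nat \<Rightarrow> complex)" where
  "gauss_borel u = (THE (S, H). is_gauss_borel u S H)"

definition gauss_borel_S :: "(complex poly \<Rightarrow> complex) \<Rightarrow> complex smat" where
  "gauss_borel_S u = fst (gauss_borel u)"

definition gauss_borel_H :: "(complex poly \<Rightarrow> complex) \<Rightarrow> nat \<Rightarrow> complex" where
  "gauss_borel_H u = snd (gauss_borel u)"

text \<open>The \<open>n\<close>-th entry of \<open>S (1, x, x\<^sup>2, \<dots>)\<^sup>T\<close>.\<close>

definition monic_op :: "(complex poly \<Rightarrow> complex) \<Rightarrow> nat \<Rightarrow> complex poly" where
  "monic_op u n = Sum_any (\<lambda>j. smult (gauss_borel_S u n j) (monom 1 j))"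

definition cd_kernel :: "(complex poly \<Rightarrow> complex) \<Rightarrow> nat \<Rightarrow> complex \<Rightarrow> complex \<Rightarrow> complex" where
  "cd_kernel u n x y =
     (\<Sum>k=0..n. poly (monic_op u k) y * inverse (gauss_borel_H u k) * poly (monic_op u k) x)"

end

theory Submission imports Defs begin

text \<open>
  Pair polynomials by \<open>\<langle>p, q\<rangle> = u (p q)\<close>; the moment matrix is the Gram matrix of the monomials.
  A polynomial of degree below \<open>n\<close> that is orthogonal to \<open>1, x, \<dots>, x\<^sup>n\<^sup>-\<^sup>1\<close> has its coefficient
  vector in the kernel of the \<open>n\<close>-th truncation, so quasi-definiteness forces it to vanish
  (\<open>quasi_definite_nondegenerate\<close>). The whole proof draws on quasi-definiteness through this fact,
  together with solvability of the truncated linear systems: for each \<open>n\<close> there is exactly one monic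
  polynomial \<open>P\<^sub>n\<close> of degree \<open>n\<close> orthogonal to all lower degrees, and \<open>h\<^sub>n = u (P\<^sub>n x\<^sup>n)\<close> is not zero.

  For such a sequence every polynomial has a Fourier expansion (\<open>fourier_expansion\<close>). Because
  multiplication by \<open>x\<close> is symmetric for the pairing, the expansion of \<open>x P\<^sub>n\<close> has at most three terms
  (\<open>three_term_recurrence\<close>). The recurrence makes the right-hand side of the Christoffel--Darboux
  formula grow by exactly \<open>(x - y) P\<^sub>n(x) P\<^sub>n(y) / h\<^sub>n\<close> from \<open>n - 1\<close> to \<open>n\<close>, so the formula telescopes;
  the confluent version is its derivative in the first variable on the diagonal.

  It remains to see that the polynomials read off from the Gauss--Borel factorization are these
  \<open>P\<^sub>n\<close>, with \<open>H\<^sub>n = h\<^sub>n\<close>. If \<open>G = S\<^sup>-\<^sup>1 H S\<^sup>-\<^sup>T\<close> then \<open>S G = H S\<^sup>-\<^sup>T\<close> is upper triangular with diagonal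
  \<open>H\<close>, and row \<open>n\<close> of this says that the polynomial with coefficients \<open>S\<^sub>n\<^sub>j\<close> is monic orthogonal with
  norm \<open>H\<^sub>n\<close> (\<open>gauss_borel_row\<close>). So at most one factorization exists. Conversely, the coefficients of
  the \<open>P\<^sub>n\<close> do give one, the inverse matrix consisting of the Fourier coefficients of the monomials
  (\<open>is_gauss_borel_coeffs\<close>). The definite description that selects the factorization is thereby
  justified.
\<close>

section \<open>Functionals and nondegeneracy\<close>

lemma linear_functional_add: "linear_functional u \<Longrightarrow> u (p + q) = u p + u q"
  unfolding linear_functional_def by (rule module_hom.add[OF Vector_Spaces.linear.axioms(3)])

lemma linear_functional_smult: "linear_functional u \<Longrightarrow> u (smult c p) = c * u p"
  unfolding linear_functional_def by (rule module_hom.scale[OF Vector_Spaces.linear.axioms(3)])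

lemma linear_functional_diff:
  assumes "linear_functional u"
  shows "u (p - q) = u p - u q"
  using linear_functional_add[OF assms, of "p - q" q] by simp

lemma linear_functional_sum:
  assumes "linear_functional u"
  shows "u (\<Sum>i\<in>A. f i) = (\<Sum>i\<in>A. u (f i))"
proof -
  have "u 0 = 0"
    using linear_functional_smult[OF assms, of 0 0] by simp
  then show ?thesis
    by (induction A rule: infinite_finite_induct) (simp_all add: linear_functional_add[OF assms])
qed

lemma linear_functional_mult_expand:
  assumes "linear_functional u" and "degree p \<le> n"
  shows "u (p * q) = (\<Sum>i\<le>n. coeff p i * u (monom 1 i * q))"
proof -
  have "p = (\<Sum>i\<le>n. smult (coeff p i) (monom 1 i))"
    using poly_as_sum_of_monoms'[OF assms(2)] by (simp add: smult_monom)
  then have "p * q = (\<Sum>i\<le>n. smult (coeff p i) (monom 1 i * q))"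
    by (metis (no_types, lifting) mult_smult_left sum.cong sum_distrib_right)
  then show ?thesis
    by (simp add: linear_functional_sum[OF assms(1)] linear_functional_smult[OF assms(1)])
qed

lemma moment_matrix_mult_coeffs:
  assumes "linear_functional u" and "i < n" and "\<And>k. k \<ge> n \<Longrightarrow> coeff p k = 0"
  shows "(mat n n (\<lambda>(i, j). moment_matrix u i j) *\<^sub>v vec n (coeff p)) $ i = u (p * monom 1 i)"
proof -
  from assms(2) obtain m where m: "n = Suc m"
    by (cases n) auto
  have "degree p \<le> m"
    by (rule degree_le) (simp add: assms(3) m)
  then have "u (p * monom 1 i) = (\<Sum>k<n. coeff p k * u (monom 1 (k + i)))"
    by (simp add: linear_functional_mult_expand[OF assms(1)] mult_monom m lessThan_Suc_atMost)
  also have "\<dots> = (mat n n (\<lambda>(i, j). moment_matrix u i j) *\<^sub>v vec n (coeff p)) $ i"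
    using assms(2)
    by (simp add: scalar_prod_def moment_matrix_def lessThan_atLeast0 mult.commute add.commute)
  finally show ?thesis ..
qed

text \<open>
  The degree bound is expressed by vanishing coefficients so that it also makes sense for
  \<open>n = 0\<close>, where it says \<open>p = 0\<close>.
\<close>

lemma quasi_definite_nondegenerate:
  assumes "linear_functional u" and "quasi_definite u"
    and deg: "\<And>k. k \<ge> n \<Longrightarrow> coeff p k = 0"
    and orth: "\<And>j. j < n \<Longrightarrow> u (p * monom 1 j) = 0"
  shows "p = 0"
proof -
  let ?G = "mat n n (\<lambda>(i, j). moment_matrix u i j)"
  have "?G *\<^sub>v vec n (coeff p) = 0\<^sub>v n"
    using moment_matrix_mult_coeffs[OF assms(1) _ deg] orth by (intro eq_vecI) auto
  moreover have "det ?G \<noteq> 0"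
    using assms(2) by (simp add: quasi_definite_def)
  ultimately have "vec n (coeff p) = 0\<^sub>v n"
    using det_0_iff_vec_prod_zero[of ?G n] by (metis mat_carrier vec_carrier)
  then have "coeff p k = 0" if "k < n" for k
    using that by (metis index_vec index_zero_vec(1))
  then show ?thesis
    using deg by (metis leading_coeff_0_iff not_less)
qed

section \<open>Monic orthogonal polynomials\<close>

definition monic_orthogonal :: "(complex poly \<Rightarrow> complex) \<Rightarrow> nat \<Rightarrow> complex poly \<Rightarrow> bool" where
  "monic_orthogonal u n p \<longleftrightarrow>
     degree p = n \<and> coeff p n = 1 \<and> (\<forall>j<n. u (p * monom 1 j) = 0)"

text \<open>
  Writing the wanted polynomial as \<open>x\<^sup>n - q\<close> with \<open>q\<close> of lower degree, the orthogonality relations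
  become a square linear system for the coefficients of \<open>q\<close>, with an invertible moment matrix.
\<close>

lemma monic_orthogonal_exists:
  assumes "linear_functional u" and "quasi_definite u"
  shows "\<exists>p. monic_orthogonal u n p"
proof -
  let ?G = "mat n n (\<lambda>(i, j). moment_matrix u i j)"
  let ?b = "vec n (\<lambda>j. u (monom 1 (n + j)))"
  have "?G \<in> Units (ring_mat TYPE(complex) n ())"
    using assms(2) by (intro det_non_zero_imp_unit) (auto simp: quasi_definite_def)
  then obtain B where B: "B \<in> carrier_mat n n" "?G * B = 1\<^sub>m n"
    by (auto simp: Units_def ring_mat_def)
  let ?v = "B *\<^sub>v ?b"
  have v: "?v \<in> carrier_vec n"
    using B(1) by auto
  have Gv: "?G *\<^sub>v ?v = ?b"
    using B by (subst assoc_mult_mat_vec[symmetric, where n\<^sub>1 = n and n\<^sub>2 = n and n\<^sub>3 = n]) auto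
  define q where "q = (\<Sum>k<n. monom (?v $ k) k)"
  have coeff_q: "coeff q k = (if k < n then ?v $ k else 0)" for k
    by (simp add: q_def coeff_sum)
  have vec_q: "vec n (coeff q) = ?v"
    by (rule eq_vecI) (use B(1) in \<open>simp_all add: coeff_q del: index_mult_mat_vec\<close>)
  have "u (q * monom 1 j) = u (monom 1 (n + j))" if "j < n" for j
    using moment_matrix_mult_coeffs[OF assms(1) that, of q] that
    by (simp only: vec_q Gv) (simp add: coeff_q)
  then have "u ((monom 1 n - q) * monom 1 j) = 0" if "j < n" for j
    using that by (simp add: algebra_simps linear_functional_diff[OF assms(1)] mult_monom)
  moreover have "coeff (monom 1 n - q) n = 1"
    by (simp add: coeff_q)
  moreover from this have "degree (monom 1 n - q) = n"
    by (intro antisym degree_le le_degree) (auto simp: coeff_q)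
  ultimately show ?thesis
    unfolding monic_orthogonal_def by blast
qed

lemma monic_orthogonal_unique:
  assumes "linear_functional u" and "quasi_definite u"
    and "monic_orthogonal u n p" and "monic_orthogonal u n q"
  shows "p = q"
proof -
  have "p - q = 0"
  proof (rule quasi_definite_nondegenerate[OF assms(1,2), of n])
    fix k assume "n \<le> k"
    then show "coeff (p - q) k = 0"
      using assms(3,4) by (cases "k = n") (auto simp: monic_orthogonal_def coeff_eq_0)
  qed (use assms(3,4) in \<open>auto simp: monic_orthogonal_def algebra_simps
        linear_functional_diff[OF assms(1)]\<close>)
  then show ?thesis by simp
qed

text \<open>
  If the norm vanished, \<open>p\<close> would be orthogonal to \<open>x\<^sup>n\<close> as well, and the nondegeneracy of the
  next larger moment matrix would give \<open>p = 0\<close>.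
\<close>

lemma monic_orthogonal_norm_nonzero:
  assumes "linear_functional u" and "quasi_definite u" and "monic_orthogonal u n p"
  shows "u (p * monom 1 n) \<noteq> 0"
proof
  assume "u (p * monom 1 n) = 0"
  then have "p = 0"
    using assms(3) by (intro quasi_definite_nondegenerate[OF assms(1,2), of "Suc n"])
      (auto simp: monic_orthogonal_def coeff_eq_0 less_Suc_eq)
  with assms(3) show False
    by (simp add: monic_orthogonal_def)
qed

text \<open>
  The norms \<open>h\<close> are a parameter rather than a definition, so that the locale can be instantiated
  directly with the diagonal factor of a Gauss--Borel factorization.
\<close>

locale monic_orthogonal_sequence =
  fixes u :: "complex poly \<Rightarrow> complex" and P :: "nat \<Rightarrow> complex poly" and h :: "nat \<Rightarrow> complex"
  assumes linear: "linear_functional u"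
    and orthogonal: "monic_orthogonal u n (P n)"
    and norm: "u (P n * monom 1 n) = h n"
    and norm_nonzero: "h n \<noteq> 0"
begin

lemma degree_P [simp]: "degree (P n) = n"
  and coeff_P_self [simp]: "coeff (P n) n = 1"
  using orthogonal[of n] by (auto simp: monic_orthogonal_def)

text \<open>
  By orthogonality only the monomial \<open>x\<^sup>n\<close> of \<open>p\<close> can pair nontrivially with \<open>P n\<close>.
\<close>

lemma functional_mult_P:
  assumes "degree p \<le> n"
  shows "u (p * P n) = coeff p n * h n"
proof -
  have "u (monom 1 i * P n) = 0" if "i < n" for i
    using orthogonal[of n] that by (simp add: monic_orthogonal_def mult.commute)
  then have "(\<Sum>i<n. coeff p i * u (monom 1 i * P n)) = 0"
    by simp
  then show ?thesis
    using norm[of n]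
    by (simp add: linear_functional_mult_expand[OF linear assms] lessThan_Suc_atMost[symmetric]
        mult.commute)
qed

lemma functional_P_mult_P: "u (P m * P n) = (if m = n then h n else 0)"
proof -
  have "u (P i * P j) = (if i = j then h j else 0)" if "i \<le> j" for i j
    using functional_mult_P[of "P i" j] that by (auto simp: coeff_eq_0)
  from this[of m n] this[of n m] show ?thesis
    by (cases "m \<le> n") (auto simp: mult.commute)
qed

text \<open>
  The difference \<open>D\<close> of the two sides is orthogonal to \<open>P 0, \<dots>, P n\<close>. Pairing it with the member of
  its own degree gives its leading coefficient times a nonzero norm, so that coefficient is zero.
\<close>

lemma fourier_expansion:
  assumes "degree p \<le> n"
  shows "p = (\<Sum>k\<le>n. smult (u (p * P k) / h k) (P k))"
proof -
  define D where "D = p - (\<Sum>k\<le>n. smult (u (p * P k) / h k) (P k))"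
  have deg: "degree D \<le> n"
    unfolding D_def using assms
    by (intro degree_diff_le degree_sum_le) (auto intro: order.trans[OF degree_smult_le])
  have "u (D * P j) = 0" if "j \<le> n" for j
  proof -
    have "u (D * P j) = u (p * P j) - (\<Sum>k\<le>n. u (p * P k) / h k * u (P k * P j))"
      by (simp add: D_def left_diff_distrib sum_distrib_right linear_functional_diff[OF linear]
          linear_functional_sum[OF linear] linear_functional_smult[OF linear])
    also have "\<dots> = 0"
      using that norm_nonzero[of j] by (simp add: functional_P_mult_P if_distrib cong: if_cong)
    finally show ?thesis .
  qed
  from this[OF deg] have "lead_coeff D = 0"
    using functional_mult_P[of D "degree D"] norm_nonzero by simp
  then have "D = 0"
    by simp
  then show ?thesis
    by (simp add: D_def)
qed

text \<open>
  The Fourier coefficient of \<open>x P\<^sub>n\<^sub>+\<^sub>1\<close> at \<open>P\<^sub>k\<close> pairs \<open>P\<^sub>n\<^sub>+\<^sub>1\<close> with \<open>x P\<^sub>k\<close>, which has degree \<open>k + 1\<close>: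
  it vanishes for \<open>k < n\<close>, and for \<open>k = n\<close> the numerator is the full norm \<open>h\<^sub>n\<^sub>+\<^sub>1\<close>. The index shift keeps
  \<open>P\<^sub>n\<close> meaningful; the case \<open>x P\<^sub>0\<close> has only two terms.
\<close>

lemma three_term_recurrence:
  "[:0, 1:] * P (Suc n) =
     P (Suc (Suc n)) + smult (u ([:0, 1:] * P (Suc n) * P (Suc n)) / h (Suc n)) (P (Suc n))
       + smult (h (Suc n) / h n) (P n)"
proof -
  let ?q = "[:0, 1:] * P (Suc n)"
  have deg: "degree ([:0, 1:] * P k) = Suc k" for k
  proof -
    have "P k \<noteq> 0" using coeff_P_self[of k] by force
    then show ?thesis by (simp add: degree_mult_eq)
  qed
  have move: "u (?q * P k) = u (([:0, 1:] * P k) * P (Suc n))" for k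
    by (simp only: mult_ac)
  have low: "u (?q * P k) = 0" if "k < n" for k
    using functional_mult_P[of "[:0, 1:] * P k" "Suc n"] that deg[of k]
    by (simp add: move coeff_eq_0 del: mult_pCons_left)
  have mid: "u (?q * P n) = h (Suc n)"
    using functional_mult_P[of "[:0, 1:] * P n" "Suc n"] deg[of n]
    by (simp only: move) simp
  have top: "u (?q * P (Suc (Suc n))) = h (Suc (Suc n))"
    using functional_mult_P[of ?q "Suc (Suc n)"] deg[of "Suc n"] by simp
  have "?q = (\<Sum>k\<le>Suc (Suc n). smult (u (?q * P k) / h k) (P k))"
    using deg[of "Suc n"] by (intro fourier_expansion) simp
  also have "\<dots> = (\<Sum>k<n. smult (u (?q * P k) / h k) (P k))
      + smult (u (?q * P n) / h n) (P n)
      + smult (u (?q * P (Suc n)) / h (Suc n)) (P (Suc n))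
      + smult (u (?q * P (Suc (Suc n))) / h (Suc (Suc n))) (P (Suc (Suc n)))"
    by (simp only: lessThan_Suc_atMost[symmetric] sum.lessThan_Suc)
  also have "(\<Sum>k<n. smult (u (?q * P k) / h k) (P k)) = 0"
    by (intro sum.neutral) (simp add: low del: mult_pCons_left)
  finally show ?thesis
    using norm_nonzero[of "Suc (Suc n)"]
    by (simp only: mid top) (simp add: add_ac del: mult_pCons_left)
qed

text \<open>
  Substituting the recurrence for \<open>P\<^sub>n\<^sub>+\<^sub>2\<close> into the right-hand side at \<open>n + 1\<close>, the middle coefficient
  \<open>b\<close> cancels by antisymmetry, and the ratio \<open>h\<^sub>n\<^sub>+\<^sub>1 / h\<^sub>n\<close> turns the last term into the right-hand side
  at \<open>n\<close>.
\<close>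

lemma christoffel_darboux:
  "(x - y) * (\<Sum>k\<le>n. poly (P k) x * poly (P k) y / h k) =
     (poly (P (Suc n)) x * poly (P n) y - poly (P n) x * poly (P (Suc n)) y) / h n"
proof (induction n)
  case 0
  have "P 0 = 1"
    using degree_P[of 0] coeff_P_self[of 0] by (metis degree_0_id one_pCons)
  moreover have "poly (P 1) z = coeff (P 1) 0 + z" for z
    using coeff_P_self[of 1] by (simp add: poly_altdef)
  ultimately show ?case by simp
next
  case (Suc n)
  define b where "b = u ([:0, 1:] * P (Suc n) * P (Suc n)) / h (Suc n)"
  have rec: "poly (P (Suc (Suc n))) z = (z - b) * poly (P (Suc n)) z
      - h (Suc n) / h n * poly (P n) z" for z
    using arg_cong[OF three_term_recurrence[of n], of "\<lambda>p. poly p z"]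
    by (simp add: b_def algebra_simps)
  show ?case
    using Suc norm_nonzero[of n] norm_nonzero[of "Suc n"]
    by (simp add: distrib_left rec) (simp add: field_simps)
qed

text \<open>
  With one variable fixed at \<open>x\<close>, the previous formula is an identity of polynomials in the other.
  Its left-hand side has the factor \<open>t - x\<close>, so differentiating and evaluating at \<open>t = x\<close> leaves
  exactly the kernel on the diagonal.
\<close>

lemma christoffel_darboux_confluent:
  "(\<Sum>k\<le>n. (poly (P k) x)\<^sup>2 / h k) =
     (poly (pderiv (P (Suc n))) x * poly (P n) x - poly (pderiv (P n)) x * poly (P (Suc n)) x) / h n"
proof -
  define K where "K = (\<Sum>k\<le>n. smult (poly (P k) x / h k) (P k))"
  have "poly ([:-x, 1:] * K) t = poly (smult (1 / h n)
      (smult (poly (P n) x) (P (Suc n)) - smult (poly (P (Suc n)) x) (P n))) t" for t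
    using christoffel_darboux[of t x n] by (simp add: K_def poly_sum field_simps)
  then have "[:-x, 1:] * K = smult (1 / h n)
      (smult (poly (P n) x) (P (Suc n)) - smult (poly (P (Suc n)) x) (P n))"
    by (simp only: poly_eq_poly_eq_iff[symmetric] fun_eq_iff) simp
  from arg_cong[OF this, of "\<lambda>p. poly (pderiv p) x"]
  have "poly K x = (poly (P n) x * poly (pderiv (P (Suc n))) x
      - poly (P (Suc n)) x * poly (pderiv (P n)) x) / h n"
    by (simp add: pderiv_mult pderiv_smult pderiv_diff pderiv_pCons del: mult_pCons_left)
  then show ?thesis
    by (simp add: K_def poly_sum power2_eq_square mult.commute)
qed

end

section \<open>The Gauss--Borel factorization\<close>

lemma smat_mult_lower_triangular:
  assumes "\<And>k. i < k \<Longrightarrow> A i k = 0"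
  shows "(A \<odot> B) i j = (\<Sum>k\<le>i. A i k * B k j)"
  unfolding smat_mult_def
  by (rule Sum_any.expand_superset) (use assms in \<open>force simp: not_less[symmetric]\<close>)+

lemma smat_mult_diag: "(A \<odot> smat_diag d) i j = A i j * d j"
proof -
  have "(A \<odot> smat_diag d) i j = (\<Sum>k\<in>{j}. A i k * smat_diag d k j)"
    unfolding smat_mult_def by (rule Sum_any.expand_superset) (auto simp: smat_diag_def)
  then show ?thesis
    by (simp add: smat_diag_def)
qed

lemma lower_triangular_congruence:
  assumes "lower_unitriangular T"
  shows "(T \<odot> smat_diag H \<odot> smat_transpose T) i j = (\<Sum>k\<le>i. T i k * H k * T j k)"
  by (subst smat_mult_lower_triangular)
    (use assms in \<open>auto simp: smat_mult_diag smat_transpose_def lower_unitriangular_def\<close>)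

definition row_poly :: "complex smat \<Rightarrow> nat \<Rightarrow> complex poly" where
  "row_poly S n = (\<Sum>j\<le>n. monom (S n j) j)"

lemma coeff_row_poly: "coeff (row_poly S n) j = (if j \<le> n then S n j else 0)"
  by (simp add: row_poly_def coeff_sum)

text \<open>
  Both claims are row \<open>n\<close> of the identity \<open>S G = H T\<^sup>T\<close>, with \<open>T\<close> the inverse of \<open>S\<close>: the entry in column
  \<open>j\<close> is \<open>u\<close> of the row polynomial times \<open>x\<^sup>j\<close>, and \<open>T\<^sup>T\<close> is upper unitriangular.
\<close>

lemma gauss_borel_row:
  assumes "linear_functional u" and "is_gauss_borel u S H"
  shows "monic_orthogonal u n (row_poly S n)" and "u (row_poly S n * monom 1 n) = H n"
proof -
  obtain T where T: "lower_unitriangular S" "lower_unitriangular T" "S \<odot> T = smat_one"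
    and G: "moment_matrix u = T \<odot> smat_diag H \<odot> smat_transpose T"
    using assms(2) by (auto simp: is_gauss_borel_def unitriangular_inverse_def)
  have coeff_top: "coeff (row_poly S n) n = 1"
    using T(1) by (simp add: coeff_row_poly lower_unitriangular_def)
  then have deg: "degree (row_poly S n) = n"
    by (intro antisym degree_le le_degree) (auto simp: coeff_row_poly)
  have T_upper: "T i k = 0" if "i < k" for i k
    using T(2) that by (simp add: lower_unitriangular_def)
  have pairing: "u (row_poly S n * monom 1 j) = H n * T j n" for j
  proof -
    have "u (row_poly S n * monom 1 j) = (\<Sum>i\<le>n. S n i * moment_matrix u i j)"
      by (simp add: linear_functional_mult_expand[OF assms(1), of _ n] deg coeff_row_poly
          mult_monom moment_matrix_def)
    also have "\<dots> = (\<Sum>i\<le>n. S n i * (\<Sum>k\<le>n. T i k * H k * T j k))"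
    \<comment> \<open>The inner sums get a range independent of \<open>i\<close>, so that the order of summation can be swapped.\<close>
    proof (rule sum.cong[OF refl])
      fix i assume "i \<in> {..n}"
      then have "(\<Sum>k\<le>i. T i k * H k * T j k) = (\<Sum>k\<le>n. T i k * H k * T j k)"
        by (intro sum.mono_neutral_left) (auto simp: T_upper)
      then show "S n i * moment_matrix u i j = S n i * (\<Sum>k\<le>n. T i k * H k * T j k)"
        by (simp add: G lower_triangular_congruence[OF T(2)])
    qed
    also have "\<dots> = (\<Sum>k\<le>n. (\<Sum>i\<le>n. S n i * T i k) * (H k * T j k))"
      by (simp only: sum_distrib_left sum_distrib_right mult.assoc) (rule sum.swap)
    also have "\<dots> = (\<Sum>k\<le>n. (S \<odot> T) n k * (H k * T j k))"
      using T(1) by (simp add: smat_mult_lower_triangular lower_unitriangular_def)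
    also have "\<dots> = H n * T j n"
      by (simp add: T(3) smat_one_def smat_diag_def if_distrib[of "\<lambda>x. x * _"] cong: if_cong)
    finally show ?thesis .
  qed
  show "monic_orthogonal u n (row_poly S n)"
    using deg coeff_top by (simp add: monic_orthogonal_def pairing T_upper)
  show "u (row_poly S n * monom 1 n) = H n"
    using T(2) by (simp add: pairing lower_unitriangular_def)
qed

context monic_orthogonal_sequence
begin

text \<open>
  The inverse of the coefficient matrix must express monomials in the \<open>P k\<close>, so its entries are
  the Fourier coefficients \<open>u (x\<^sup>n P\<^sub>k) / h\<^sub>k\<close>. One inverse law is then orthogonality of the \<open>P k\<close>, the
  other is the Fourier expansion of \<open>x\<^sup>n\<close>; pairing that expansion with \<open>x\<^sup>m\<close> gives the factorization.
\<close>

lemma is_gauss_borel_coeffs: "is_gauss_borel u (\<lambda>n. coeff (P n)) h"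
proof -
  define S where "S = (\<lambda>n. coeff (P n))"
  define T where "T = (\<lambda>n k. u (monom 1 n * P k) / h k)"
  have S: "lower_unitriangular S"
    by (auto simp: lower_unitriangular_def S_def coeff_eq_0)
  have "T n k = (if n = k then 1 else 0)" if "n \<le> k" for n k
    using functional_mult_P[of "monom 1 n" k] norm_nonzero[of k] that
    by (simp add: T_def degree_monom_eq)
  then have T: "lower_unitriangular T"
    by (simp add: lower_unitriangular_def)
  have expand: "monom 1 n = (\<Sum>k\<le>n. smult (T n k) (P k))" for n
    unfolding T_def by (rule fourier_expansion) (simp add: degree_monom_eq)
  have "S \<odot> T = smat_one"
  proof (intro ext)
    fix i j
    have "(S \<odot> T) i j = (\<Sum>k\<le>i. coeff (P i) k * u (monom 1 k * P j)) / h j"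
      using S by (simp add: smat_mult_lower_triangular lower_unitriangular_def)
        (simp add: S_def T_def sum_divide_distrib)
    also have "\<dots> = u (P i * P j) / h j"
      by (simp add: linear_functional_mult_expand[OF linear, of "P i" i])
    finally show "(S \<odot> T) i j = smat_one i j"
      using norm_nonzero[of j] by (simp add: functional_P_mult_P smat_one_def smat_diag_def)
  qed
  moreover have "T \<odot> S = smat_one"
  proof (intro ext)
    fix i j
    have "(T \<odot> S) i j = (\<Sum>k\<le>i. T i k * coeff (P k) j)"
      using T by (simp add: smat_mult_lower_triangular lower_unitriangular_def S_def)
    also have "\<dots> = coeff (monom 1 i) j"
      by (subst expand) (simp add: coeff_sum)
    finally show "(T \<odot> S) i j = smat_one i j"
      by (simp add: smat_one_def smat_diag_def)
  qed
  moreover have "moment_matrix u = T \<odot> smat_diag h \<odot> smat_transpose T"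
  proof (intro ext)
    fix i j
    have "moment_matrix u i j = u (monom 1 i * monom 1 j)"
      by (simp add: moment_matrix_def mult_monom)
    also have "\<dots> = u ((\<Sum>k\<le>i. smult (T i k) (P k)) * monom 1 j)"
      by (simp only: expand[of i, symmetric])
    also have "\<dots> = (\<Sum>k\<le>i. T i k * u (P k * monom 1 j))"
      by (simp add: sum_distrib_right linear_functional_sum[OF linear]
          linear_functional_smult[OF linear])
    also have "\<dots> = (\<Sum>k\<le>i. T i k * h k * T j k)"
      using norm_nonzero by (simp add: T_def mult.commute[of "P _"])
    finally show "moment_matrix u i j = (T \<odot> smat_diag h \<odot> smat_transpose T) i j"
      by (simp add: lower_triangular_congruence[OF T])
  qed
  ultimately show ?thesis
    using S T unfolding S_def[symmetric] is_gauss_borel_def unitriangular_inverse_def by blast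
qed

end

text \<open>
  The rows of any factorization are determined by the uniqueness of monic orthogonal polynomials,
  so the description in \<^const>\<open>gauss_borel\<close> denotes.
\<close>

lemma is_gauss_borel_gauss_borel:
  assumes "linear_functional u" and "quasi_definite u"
  shows "is_gauss_borel u (gauss_borel_S u) (gauss_borel_H u)"
proof -
  obtain P where P: "\<And>n. monic_orthogonal u n (P n)"
    using monic_orthogonal_exists[OF assms] by metis
  define h where "h = (\<lambda>n. u (P n * monom 1 n))"
  interpret monic_orthogonal_sequence u P h
    by unfold_locales
      (use assms P monic_orthogonal_norm_nonzero[OF assms P] in \<open>auto simp: h_def\<close>)
  have unique: "S = (\<lambda>n. coeff (P n)) \<and> H = h" if GB: "is_gauss_borel u S H" for S H
  proof -
    have row: "row_poly S n = P n" for n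
      using monic_orthogonal_unique[OF assms gauss_borel_row(1)[OF assms(1) GB] P] .
    have "S n j = coeff (P n) j" for n j
    proof (cases "j \<le> n")
      case True
      then show ?thesis using coeff_row_poly[of S n j] by (simp add: row)
    next
      case False
      then show ?thesis
        using GB by (auto simp: is_gauss_borel_def unitriangular_inverse_def
            lower_unitriangular_def coeff_eq_0)
    qed
    moreover have "H n = h n" for n
      using gauss_borel_row(2)[OF assms(1) GB, of n] by (simp add: row h_def)
    ultimately show ?thesis by blast
  qed
  have "gauss_borel u = (\<lambda>n. coeff (P n), h)"
    unfolding gauss_borel_def
  proof (rule the_equality)
    show "case (\<lambda>n. coeff (P n), h) of (S, H) \<Rightarrow> is_gauss_borel u S H"
      using is_gauss_borel_coeffs by (simp only: prod.case)
  next
    fix F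
    assume "case F of (S, H) \<Rightarrow> is_gauss_borel u S H"
    then show "F = (\<lambda>n. coeff (P n), h)"
      using unique[of "fst F" "snd F"] by (simp only: case_prod_beta prod_eq_iff fst_conv snd_conv)
  qed
  then show ?thesis
    using is_gauss_borel_coeffs
    by (simp only: gauss_borel_S_def gauss_borel_H_def fst_conv snd_conv)
qed

lemma monic_op_eq_row_poly:
  assumes "lower_unitriangular (gauss_borel_S u)"
  shows "monic_op u n = row_poly (gauss_borel_S u) n"
  unfolding monic_op_def row_poly_def smult_monom mult_1_right
  by (rule Sum_any.expand_superset)
    (use assms in \<open>force simp: lower_unitriangular_def not_less[symmetric]\<close>)+

lemma monic_op_orthogonal_sequence:
  assumes "linear_functional u" and "quasi_definite u"
  shows "monic_orthogonal_sequence u (monic_op u) (gauss_borel_H u)"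
proof -
  note GB = is_gauss_borel_gauss_borel[OF assms]
  have "monic_op u n = row_poly (gauss_borel_S u) n" for n
    using GB by (intro monic_op_eq_row_poly) (auto simp: is_gauss_borel_def unitriangular_inverse_def)
  note row = gauss_borel_row[OF assms(1) GB, folded this]
  show ?thesis
    by unfold_locales
      (use assms(1) row monic_orthogonal_norm_nonzero[OF assms row(1)] in auto)
qed

section \<open>The Christoffel--Darboux formulas\<close>

theorem proposition22:
  fixes u :: "complex poly \<Rightarrow> complex"
  assumes "linear_functional u" and "quasi_definite u"
  shows "(\<forall>(n::nat) (x::complex) (y::complex).
            (x - y) * cd_kernel u n x y =
              poly (monic_op u n) y * inverse (gauss_borel_H u n) * poly (monic_op u (n + 1)) x
              - poly (monic_op u (n + 1)) y * inverse (gauss_borel_H u n) * poly (monic_op u n) x)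
       \<and> (\<forall>(l::nat) (x::complex). l \<ge> 1 \<longrightarrow>
            (\<Sum>k=0..l-1. (poly (monic_op u k) x)\<^sup>2 / gauss_borel_H u k) =
              1 / gauss_borel_H u (l - 1) *
                (poly (pderiv (monic_op u l)) x * poly (monic_op u (l - 1)) x
                 - poly (pderiv (monic_op u (l - 1))) x * poly (monic_op u l) x))"
proof -
  interpret monic_orthogonal_sequence u "monic_op u" "gauss_borel_H u"
    using assms by (rule monic_op_orthogonal_sequence)
  have "(x - y) * cd_kernel u n x y =
      poly (monic_op u n) y * inverse (gauss_borel_H u n) * poly (monic_op u (n + 1)) x
      - poly (monic_op u (n + 1)) y * inverse (gauss_borel_H u n) * poly (monic_op u n) x" for n x y
  proof -
    have "cd_kernel u n x y =
        (\<Sum>k\<le>n. poly (monic_op u k) x * poly (monic_op u k) y / gauss_borel_H u k)"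
      by (simp add: cd_kernel_def atLeast0AtMost divide_inverse mult_ac)
    then show ?thesis
      using christoffel_darboux[of x y n] by (simp add: divide_inverse algebra_simps)
  qed
  moreover have "(\<Sum>k=0..l-1. (poly (monic_op u k) x)\<^sup>2 / gauss_borel_H u k) =
      1 / gauss_borel_H u (l - 1) *
        (poly (pderiv (monic_op u l)) x * poly (monic_op u (l - 1)) x
         - poly (pderiv (monic_op u (l - 1))) x * poly (monic_op u l) x)" if "l \<ge> 1" for l x
    using christoffel_darboux_confluent[of x "l - 1"] that by (simp add: atLeast0AtMost)
  ultimately show ?thesis by blast
qed

end
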